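(* Let $m\ge1$, let $\kappa_1,\kappa_2>m/2-1$, and let $\Lambda$ be an $m\times m$ Hermitian matrix with eigenvalues $\lambda_1,\dots,\lambda_m$. Let $h_r$ denote the complete symmetric polynomial of degree $r$. For every partition $\tau=(\tau_1,\dots,\tau_m)$, $$P_\tau^{(\kappa_1,\kappa_2,2)}(\Lambda)=\det\left(\left(P_{\tau_\ell+m-\ell}^{(\kappa_1-m/2,\kappa_2-m/2)}\bigl(h_{\cdot-m+j}(\Lambda)\bigr)\right)_{1\le\ell,j\le m}\right),$$ where the evaluation convention $(h_{\cdot-m+j}(\Lambda))^a=h_{a-m+j}(\Lambda)$ is used, i.e. for a one-variable polynomial $p(x)=\sum_ap_ax^a$ one sets $p(h_{\cdot-m+j}(\Lambda)):=\sum_ap_a\,h_{a-m+j}(\Lambda)$.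
   Context: A partition is $\tau=(\tau_1\ge\dots\ge\tau_m\ge0)\in\mathbb{N}^m$. $h_r(\Lambda)=h_r(\lambda_1,\dots,\lambda_m)=\sum_{\ell_1+\dots+\ell_m=r}\lambda_1^{\ell_1}\cdots\lambda_m^{\ell_m}$, with $h_0=1$ and $h_r=0$ for $r<0$. The Hermitian Jacobi polynomials are $$P_\tau^{(\kappa_1,\kappa_2,2)}(\Lambda):=\frac{\det\left(\left(P^{(\kappa_1-m/2,\kappa_2-m/2)}_{\tau_\ell+m-\ell}(\lambda_j)\right)_{1\le\ell,j\le m}\right)}{\prod_{1\le\ell<j\le m}(\lambda_\ell-\lambda_j)},$$ (a symmetric polynomial in the eigenvalues), where $P_r^{(\alpha,\beta)}$ is the $r$-th Jacobi polynomial of index $(\alpha,\beta)$ on $[0,1]$, i.e. the degree $r$ orthogonal polynomial for the weight $x^\alpha(1-x)^\beta$ on $[0,1]$ (with any fixed normalisation). *)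

theory Defs
  imports
    "HOL-Analysis.Lebesgue_Measure"
    "HOL-Analysis.Set_Integral"
    "Jordan_Normal_Form.Schur_Decomposition"
begin

text \<open>
  Vectors and matrices are indexed by 1..m as in the mathematics: a vector of reals is a function
  of type nat to real of which only the values at 1..m matter. Matrices of type \<^typ>\<open>'a mat\<close> count
  rows and columns from 0, whence the shift below.
\<close>

definition mat1 :: "nat \<Rightarrow> (nat \<Rightarrow> nat \<Rightarrow> 'a) \<Rightarrow> 'a mat" where
  "mat1 m a = mat m m (\<lambda>(i, j). a (Suc i) (Suc j))"

definition is_partition :: "nat \<Rightarrow> (nat \<Rightarrow> nat) \<Rightarrow> bool" where
  "is_partition m \<tau> \<longleftrightarrow> (\<forall>i j. 1 \<le> i \<and> i \<le> j \<and> j \<le> m \<longrightarrow> \<tau> j \<le> \<tau> i)"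

definition complete_sym :: "nat \<Rightarrow> (nat \<Rightarrow> real) \<Rightarrow> int \<Rightarrow> real" where
  "complete_sym m x r =
     (if r < 0 then 0
      else (\<Sum>l \<in> {l \<in> PiE {1..m} (\<lambda>_. UNIV). sum l {1..m} = nat r}. \<Prod>i = 1..m. x i ^ l i))"

text \<open>
  The Jacobi polynomials of index \<open>(\<alpha>, \<beta>)\<close> on the unit interval, up to normalisation: a family
  satisfies this predicate iff each member is a nonzero scalar multiple of the Jacobi polynomial of
  the same degree. The condition \<open>P r \<noteq> 0\<close> is only needed for \<open>r = 0\<close>. The predicate is meant for
  \<open>\<alpha>, \<beta> > -1\<close>, when all these integrals converge absolutely.
\<close>

definition jacobi_polynomials :: "real \<Rightarrow> real \<Rightarrow> (nat \<Rightarrow> real poly) \<Rightarrow> bool" where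
  "jacobi_polynomials \<alpha> \<beta> P \<longleftrightarrow>
     (\<forall>r. P r \<noteq> 0 \<and> degree (P r) = r) \<and>
     (\<forall>r s. r \<noteq> s \<longrightarrow>
        (LINT x:{0..1}|lborel. poly (P r) x * poly (P s) x * (x powr \<alpha> * (1 - x) powr \<beta>)) = 0)"

definition polynomial_fun :: "nat \<Rightarrow> ((nat \<Rightarrow> real) \<Rightarrow> real) \<Rightarrow> bool" where
  "polynomial_fun m f \<longleftrightarrow>
     (\<exists>(E :: (nat \<Rightarrow> nat) set) c. finite E \<and>
        (\<forall>x. f x = (\<Sum>e\<in>E. c e * (\<Prod>i = 1..m. x i ^ e i))))"

text \<open>
  The quotient of determinants defining the Hermitian Jacobi polynomial makes sense literally only
  for pairwise distinct eigenvalues. As a polynomial in the eigenvalues it is the unique polynomial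
  function that agrees with the quotient there, and so has a value at all points. The argument \<open>P\<close>
  is the family of one-variable Jacobi polynomials of index \<open>(\<kappa>1 - m/2, \<kappa>2 - m/2)\<close>.
\<close>

definition hermitian_jacobi ::
  "nat \<Rightarrow> (nat \<Rightarrow> real poly) \<Rightarrow> (nat \<Rightarrow> nat) \<Rightarrow> (nat \<Rightarrow> real) \<Rightarrow> real" where
  "hermitian_jacobi m P \<tau> =
     (THE f. polynomial_fun m f \<and>
        (\<forall>x. inj_on x {1..m} \<longrightarrow>
           f x = det (mat1 m (\<lambda>l j. poly (P (\<tau> l + m - l)) (x j)))
                 / (\<Prod>(l, j) \<in> {(l, j). 1 \<le> l \<and> l < j \<and> j \<le> m}. x l - x j)))"

text \<open>Umbral evaluation: the power with exponent \<open>a\<close> is replaced by \<open>h (a - m + j)\<close>.\<close>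

definition poly_at_h :: "nat \<Rightarrow> (int \<Rightarrow> real) \<Rightarrow> nat \<Rightarrow> real poly \<Rightarrow> real" where
  "poly_at_h m h j p = (\<Sum>a\<le>degree p. coeff p a * h (int a - int m + int j))"

text \<open>\<open>x 1, \<dots>, x m\<close> are the eigenvalues of \<open>A\<close>, listed with multiplicity in some order.\<close>

definition real_eigenvalues :: "nat \<Rightarrow> complex mat \<Rightarrow> (nat \<Rightarrow> real) \<Rightarrow> bool" where
  "real_eigenvalues m A x \<longleftrightarrow> char_poly A = (\<Prod>i = 1..m. [:- complex_of_real (x i), 1:])"

end

theory Submission
  imports Defs
begin

text \<open>
  Let \<open>b k j\<close> be the coefficient of \<open>X ^ (k - 1)\<close> in the product of the \<open>X - x i\<close> over \<open>i \<noteq> j\<close>.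
  Summing \<open>h (a - m + k) * b k j\<close> over \<open>k\<close> gives \<open>x j ^ a\<close>, because every linear factor removes one
  variable from the complete symmetric polynomials until only \<open>x j\<close> is left. Hence the matrix of the
  \<open>p l (x j)\<close> is the umbral matrix times \<open>b\<close>, and \<open>det b\<close> is the Vandermonde product. The
  identity extends to coinciding eigenvalues because both sides are polynomial functions.
\<close>

subsection \<open>Complete symmetric polynomials\<close>

text \<open>A general index set lets variables be removed one at a time. \<open>PiE\<close> pins the
  exponents outside \<open>S\<close>, so each monomial is counted once.\<close>

definition complete_sym_on :: "nat set \<Rightarrow> (nat \<Rightarrow> real) \<Rightarrow> int \<Rightarrow> real" where
  "complete_sym_on S x r =
     (if r < 0 then 0
      else (\<Sum>l \<in> {l \<in> PiE S (\<lambda>_. UNIV). sum l S = nat r}. \<Prod>i\<in>S. x i ^ l i))"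

lemma complete_sym_eq: "complete_sym m x r = complete_sym_on {1..m} x r"
  by (simp add: complete_sym_def complete_sym_on_def)

lemma finite_exponents:
  assumes "finite S"
  shows "finite {l \<in> PiE S (\<lambda>_. UNIV :: nat set). sum l S = n}"
proof (rule finite_subset)
  show "{l \<in> PiE S (\<lambda>_. UNIV). sum l S = n} \<subseteq> PiE S (\<lambda>_. {..n})"
  proof
    fix l assume l: "l \<in> {l \<in> PiE S (\<lambda>_. UNIV :: nat set). sum l S = n}"
    then have "l i \<le> n" if "i \<in> S" for i
      using member_le_sum[of i S l] assms that by auto
    with l show "l \<in> PiE S (\<lambda>_. {..n})" by (auto simp: PiE_iff)
  qed
  show "finite (PiE S (\<lambda>_. {..n}))"
    using assms by (intro finite_PiE) auto
qed

lemma complete_sym_on_neg: "r < 0 \<Longrightarrow> complete_sym_on S x r = 0"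
  by (simp add: complete_sym_on_def)

lemma complete_sym_on_0:
  assumes "finite S"
  shows "complete_sym_on S x 0 = 1"
proof -
  have "{l \<in> PiE S (\<lambda>_. UNIV :: nat set). sum l S = 0} = {\<lambda>i\<in>S. 0}"
    using assms by (auto simp: PiE_iff fun_eq_iff extensional_def)
  then show ?thesis by (simp add: complete_sym_on_def)
qed

lemma complete_sym_on_singleton: "complete_sym_on {i} x (int n) = x i ^ n"
proof -
  have "{l \<in> PiE {i} (\<lambda>_. UNIV :: nat set). sum l {i} = n} = {\<lambda>k\<in>{i}. n}"
    by (auto simp: PiE_iff fun_eq_iff extensional_def)
  then show ?thesis by (simp add: complete_sym_on_def)
qed

text \<open>The exponent vectors split according to whether \<open>x i\<close> occurs or not.\<close>

lemma complete_sym_on_insert: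
  assumes S: "finite S" and i: "i \<notin> S"
  shows "complete_sym_on (insert i S) x r =
    complete_sym_on S x r + x i * complete_sym_on (insert i S) x (r - 1)"
proof (cases "r < 0")
  case True
  then show ?thesis by (simp add: complete_sym_on_neg)
next
  case False
  let ?T = "insert i S"
  define A where "A = {l \<in> PiE ?T (\<lambda>_. UNIV :: nat set). sum l ?T = nat r}"
  let ?mon = "\<lambda>l::nat \<Rightarrow> nat. \<Prod>k\<in>?T. x k ^ l k"
  have "finite A" unfolding A_def using S by (intro finite_exponents) simp
  have upd: "sum (l(i := n)) ?T = n + sum l S" "(\<Prod>k\<in>?T. x k ^ (l(i := n)) k) = x i ^ n * (\<Prod>k\<in>S. x k ^ l k)"
    for l :: "nat \<Rightarrow> nat" and n
  proof -
    have "sum (l(i := n)) S = sum l S" using i by (intro sum.cong) auto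
    then show "sum (l(i := n)) ?T = n + sum l S" using S i by simp
    have "(\<Prod>k\<in>S. x k ^ (l(i := n)) k) = (\<Prod>k\<in>S. x k ^ l k)" using i by (intro prod.cong) auto
    then show "(\<Prod>k\<in>?T. x k ^ (l(i := n)) k) = x i ^ n * (\<Prod>k\<in>S. x k ^ l k)" using S i by simp
  qed
  have "complete_sym_on ?T x r = sum ?mon A"
    using False by (simp add: complete_sym_on_def A_def)
  also have "\<dots> = sum ?mon {l\<in>A. l i = 0} + sum ?mon {l\<in>A. l i \<noteq> 0}"
    using \<open>finite A\<close> by (subst sum.union_disjoint[symmetric]) (auto intro!: sum.cong)
  also have "sum ?mon {l\<in>A. l i = 0} = complete_sym_on S x r"
  proof -
    have "sum ?mon {l\<in>A. l i = 0}
      = (\<Sum>l \<in> {l \<in> PiE S (\<lambda>_. UNIV). sum l S = nat r}. \<Prod>k\<in>S. x k ^ l k)"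
    \<comment> \<open>Exponent vectors on \<open>S\<close> have the value \<open>undefined\<close>
      at \<open>i\<close>, those in \<open>A\<close> without \<open>x i\<close> the value 0; the
      bijection swaps these two values.\<close>
    proof (rule sum.reindex_bij_witness[where i = "\<lambda>l. l(i := 0)" and j = "\<lambda>l. l(i := undefined)"])
      fix l assume l: "l \<in> {l\<in>A. l i = 0}"
      then show "l(i := undefined, i := 0) = l" by auto
      have "sum (l(i := undefined)) S = sum l S" using i by (intro sum.cong) auto
      moreover have "sum l S = nat r" using l S i by (auto simp: A_def)
      ultimately show "l(i := undefined) \<in> {l \<in> PiE S (\<lambda>_. UNIV). sum l S = nat r}"
        using l by (auto simp: A_def PiE_iff extensional_def)
      have "(\<Prod>k\<in>S. x k ^ (l(i := undefined)) k) = (\<Prod>k\<in>S. x k ^ l k)"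
        using i by (intro prod.cong) auto
      then show "(\<Prod>k\<in>S. x k ^ (l(i := undefined)) k) = ?mon l" using S i l by simp
    next
      fix l assume l: "l \<in> {l \<in> PiE S (\<lambda>_. UNIV :: nat set). sum l S = nat r}"
      then show "l(i := 0, i := undefined) = l" using i by (auto simp: PiE_iff extensional_def)
      show "l(i := 0) \<in> {l\<in>A. l i = 0}"
        using l upd(1)[of l 0] by (auto simp: A_def PiE_iff extensional_def)
    qed
    then show ?thesis using False by (simp add: complete_sym_on_def)
  qed
  also have "sum ?mon {l\<in>A. l i \<noteq> 0} = x i * complete_sym_on ?T x (r - 1)"
  \<comment> \<open>For \<open>r = 0\<close> the truncated \<open>nat (r - 1)\<close> would be 0
    again. There the left sum is empty, and the right side vanishes by the convention for negative
    degrees.\<close>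
  proof (cases "r = 0")
    case True
    then have none: "{l\<in>A. l i \<noteq> 0} = {}" using S by (auto simp: A_def)
    show ?thesis unfolding none using True by (simp add: complete_sym_on_neg)
  next
    case r: False
    have "sum ?mon {l\<in>A. l i \<noteq> 0}
      = (\<Sum>l \<in> {l \<in> PiE ?T (\<lambda>_. UNIV). sum l ?T = nat (r - 1)}. x i * ?mon l)"
    \<comment> \<open>Taking out one factor \<open>x i\<close> lowers the exponent at
      \<open>i\<close> by one.\<close>
    proof (rule sum.reindex_bij_witness[where i = "\<lambda>l. l(i := l i + 1)" and j = "\<lambda>l. l(i := l i - 1)"])
      fix l assume l: "l \<in> {l\<in>A. l i \<noteq> 0}"
      then show "l(i := l i - 1, i := (l(i := l i - 1)) i + 1) = l" by auto
      have "sum l ?T = nat r" using l by (auto simp: A_def)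
      then have "l i + sum l S = nat r" using S i by simp
      then show "l(i := l i - 1) \<in> {l \<in> PiE ?T (\<lambda>_. UNIV). sum l ?T = nat (r - 1)}"
        using l upd(1)[of l "l i - 1"] False r by (auto simp: A_def PiE_iff extensional_def)
      show "x i * ?mon (l(i := l i - 1)) = ?mon l"
        unfolding upd(2) using S i l by (cases "l i") auto
    next
      fix l assume l: "l \<in> {l \<in> PiE ?T (\<lambda>_. UNIV :: nat set). sum l ?T = nat (r - 1)}"
      then show "l(i := l i + 1, i := (l(i := l i + 1)) i - 1) = l" by auto
      have "l i + sum l S = nat (r - 1)" using S i l by simp
      then show "l(i := l i + 1) \<in> {l\<in>A. l i \<noteq> 0}"
        using l upd(1)[of l "l i + 1"] False r by (auto simp: A_def PiE_iff extensional_def)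
    qed
    then show ?thesis using False r by (simp add: complete_sym_on_def sum_distrib_left)
  qed
  finally show ?thesis .
qed

text \<open>In generating functions, each factor \<open>1 - x i * t\<close> cancels
  \<open>1 / (1 - x i * t)\<close>, and only the series of \<open>x j\<close> remains. The induction
  varies \<open>c\<close> and \<open>N\<close>, since splitting off a factor turns them into
  \<open>c + 1\<close> and \<open>N - 1\<close>.\<close>

lemma umbral_prod_linear:
  assumes "finite S" and "j \<notin> S" and "card S \<le> N"
  shows "(\<Sum>k\<le>N. coeff (\<Prod>i\<in>S. [:- x i, 1:]) k * complete_sym_on (insert j S) x (c + int k))
    = complete_sym_on {j} x (c + int (card S))"
  using assms
proof (induction S arbitrary: N c rule: finite_induct)
  case empty
  then show ?case by (simp add: coeff_1 if_distrib[of "\<lambda>u. u * _"] cong: if_cong)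
next
  case (insert i S)
  let ?Q = "\<Prod>i\<in>S. [:- x i, 1:]" and ?h = "complete_sym_on (insert j (insert i S)) x"
  obtain M where N: "N = Suc M" using insert by (cases N) auto
  have M: "card S \<le> M" using insert N by auto
  \<comment> \<open>The factor \<open>X - x i\<close> acts on the sequence \<open>?h\<close> as the
    shift minus \<open>x i\<close>, which deletes the variable \<open>x i\<close>.\<close>
  have rec: "?h (r + 1) - x i * ?h r = complete_sym_on (insert j S) x (r + 1)" for r
    using complete_sym_on_insert[of "insert j S" i x "r + 1"] insert by (simp add: insert_commute)
  have deg: "degree ?Q = card S"
    by (subst degree_prod_eq_sum_degree) auto
  \<comment> \<open>\<open>?Q\<close> has degree at most \<open>M\<close>, so its sum up to
    \<open>Suc M\<close> may stop at \<open>M\<close>.\<close>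
  have co: "coeff ?Q (Suc M) = 0" using deg M by (intro coeff_eq_0) simp
  have eq: "(\<Prod>i\<in>insert i S. [:- x i, 1:]) = pCons 0 ?Q - smult (x i) ?Q"
    using insert by (simp)
  have "(\<Sum>k\<le>N. coeff (\<Prod>i\<in>insert i S. [:- x i, 1:]) k * ?h (c + int k))
     = (\<Sum>k\<le>Suc M. coeff (pCons 0 ?Q) k * ?h (c + int k)) - (\<Sum>k\<le>Suc M. coeff ?Q k * (x i * ?h (c + int k)))"
    unfolding eq N by (simp add: sum_subtractf algebra_simps)
  also have "(\<Sum>k\<le>Suc M. coeff (pCons 0 ?Q) k * ?h (c + int k)) = (\<Sum>k\<le>M. coeff ?Q k * ?h (c + int k + 1))"
    by (subst sum.atMost_Suc_shift) (simp add: algebra_simps)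
  also have "(\<Sum>k\<le>Suc M. coeff ?Q k * (x i * ?h (c + int k))) = (\<Sum>k\<le>M. coeff ?Q k * (x i * ?h (c + int k)))"
    using co by simp
  also have "(\<Sum>k\<le>M. coeff ?Q k * ?h (c + int k + 1)) - (\<Sum>k\<le>M. coeff ?Q k * (x i * ?h (c + int k)))
      = (\<Sum>k\<le>M. coeff ?Q k * complete_sym_on (insert j S) x ((c + 1) + int k))"
    by (simp only: sum_subtractf[symmetric] right_diff_distrib[symmetric] rec)
        (simp add: add.assoc add.commute add.left_commute)
  also have "\<dots> = complete_sym_on {j} x ((c + 1) + int (card S))"
    using insert.IH M insert.prems by simp
  finally show ?case using insert by (simp add: add_ac)
qed

subsection \<open>The Jacobi--Trudi factorisation\<close>

text \<open>By linearity it is enough to treat powers. Removing the \<open>m - 1\<close> variables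
  other than \<open>x j\<close> raises the index from \<open>a - m + 1\<close> to \<open>a\<close>,
  and the complete symmetric polynomial of degree \<open>a\<close> in \<open>x j\<close> alone is
  \<open>x j ^ a\<close>.\<close>

lemma poly_eq_umbral:
  assumes j: "j \<in> {1..m}"
  shows "poly p (x j) = (\<Sum>k<m. poly_at_h m (complete_sym m x) (Suc k) p
    * coeff (\<Prod>i\<in>{1..m} - {j}. [:- x i, 1:]) k)"
proof -
  let ?Q = "\<Prod>i\<in>{1..m} - {j}. [:- x i, 1:]"
  have pw: "(\<Sum>k<m. complete_sym m x (int a - int m + int (Suc k)) * coeff ?Q k) = x j ^ a" for a
  proof -
    have c: "card ({1..m} - {j}) = m - 1" using j by simp
    have ins: "insert j ({1..m} - {j}) = {1..m}" using j by auto
    have "{..<m} = {..m - 1}" using j by auto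
    then have "(\<Sum>k<m. complete_sym m x (int a - int m + int (Suc k)) * coeff ?Q k)
      = (\<Sum>k\<le>m - 1. coeff ?Q k * complete_sym_on {1..m} x ((int a - int m + 1) + int k))"
      by (simp add: complete_sym_eq algebra_simps)
    also have "\<dots> = complete_sym_on {j} x (int a - int m + 1 + int (m - 1))"
      using umbral_prod_linear[of "{1..m} - {j}" j "m - 1" x "int a - int m + 1"]
      unfolding c ins by simp
    also have "int a - int m + 1 + int (m - 1) = int a" using j by auto
    finally show ?thesis by (simp add: complete_sym_on_singleton)
  qed
  have "poly p (x j) = (\<Sum>a\<le>degree p. \<Sum>k<m. coeff p a *
      (complete_sym m x (int a - int m + int (Suc k)) * coeff ?Q k))"
    by (simp only: poly_altdef sum_distrib_left[symmetric] pw)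
  also have "\<dots> = (\<Sum>k<m. \<Sum>a\<le>degree p. coeff p a *
      (complete_sym m x (int a - int m + int (Suc k)) * coeff ?Q k))"
    by (rule sum.swap)
  also have "\<dots> = (\<Sum>k<m. poly_at_h m (complete_sym m x) (Suc k) p * coeff ?Q k)"
    by (simp add: poly_at_h_def sum_distrib_right mult.assoc)
  finally show ?thesis .
qed

lemma mat1_carrier [simp]: "mat1 m a \<in> carrier_mat m m"
  by (simp add: mat1_def)

text \<open>Entrywise this is \<open>poly_eq_umbral\<close>, and determinants are multiplicative.
  The last factor does not involve \<open>p\<close>, so a convenient choice of \<open>p\<close>
  evaluates it.\<close>

lemma det_poly_factor:
  "det (mat1 m (\<lambda>l j. poly (p l) (x j))) =
   det (mat1 m (\<lambda>l j. poly_at_h m (complete_sym m x) j (p l)))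
   * det (mat1 m (\<lambda>k j. coeff (\<Prod>i\<in>{1..m} - {j}. [:- x i, 1:]) (k - 1)))"
proof -
  have "mat1 m (\<lambda>l j. poly (p l) (x j)) =
    mat1 m (\<lambda>l j. poly_at_h m (complete_sym m x) j (p l))
    * mat1 m (\<lambda>k j. coeff (\<Prod>i\<in>{1..m} - {j}. [:- x i, 1:]) (k - 1))"
  proof (rule eq_matI)
    fix i j assume "i < dim_row (mat1 m (\<lambda>l j. poly_at_h m (complete_sym m x) j (p l))
    * mat1 m (\<lambda>k j. coeff (\<Prod>i\<in>{1..m} - {j}. [:- x i, 1:]) (k - 1)))"
     "j < dim_col (mat1 m (\<lambda>l j. poly_at_h m (complete_sym m x) j (p l))
    * mat1 m (\<lambda>k j. coeff (\<Prod>i\<in>{1..m} - {j}. [:- x i, 1:]) (k - 1)))"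
    then have ij: "i < m" "j < m" by (auto simp: mat1_def)
    then show "mat1 m (\<lambda>l j. poly (p l) (x j)) $$ (i, j) =
      (mat1 m (\<lambda>l j. poly_at_h m (complete_sym m x) j (p l))
      * mat1 m (\<lambda>k j. coeff (\<Prod>i\<in>{1..m} - {j}. [:- x i, 1:]) (k - 1))) $$ (i, j)"
      using poly_eq_umbral[of "Suc j" m "p (Suc i)" x]
      by (simp add: mat1_def scalar_prod_def atLeast0LessThan)
  qed (auto simp: mat1_def)
  then show ?thesis by (simp add: det_mult[of _ m])
qed

section \<open>Triangular matrices and the Vandermonde product\<close>

lemma det_mat1_upper:
  assumes "\<And>i j. 1 \<le> j \<Longrightarrow> j < i \<Longrightarrow> i \<le> m \<Longrightarrow> a i j = 0"
  shows "det (mat1 m a) = (\<Prod>i=1..m. a i i)"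
proof -
  have "det (mat1 m a) = prod_list (diag_mat (mat1 m a))"
    by (rule det_upper_triangular[of _ m]) (use assms in \<open>auto simp: mat1_def\<close>)
  also have "\<dots> = (\<Prod>i<m. a (Suc i) (Suc i))"
    by (simp add: prod_list_diag_prod mat1_def atLeast0LessThan)
  also have "\<dots> = (\<Prod>i=1..m. a i i)"
    by (simp add: prod.atLeast1_atMost_eq)
  finally show ?thesis .
qed

lemma det_mat1_lower:
  assumes "\<And>i j. 1 \<le> i \<Longrightarrow> i < j \<Longrightarrow> j \<le> m \<Longrightarrow> a i j = 0"
  shows "det (mat1 m a) = (\<Prod>i=1..m. a i i)"
proof -
  have "det (mat1 m a) = prod_list (diag_mat (mat1 m a))"
    by (rule det_lower_triangular[of m]) (use assms in \<open>auto simp: mat1_def\<close>)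
  also have "\<dots> = (\<Prod>i<m. a (Suc i) (Suc i))"
    by (simp add: prod_list_diag_prod mat1_def atLeast0LessThan)
  also have "\<dots> = (\<Prod>i=1..m. a i i)"
    by (simp add: prod.atLeast1_atMost_eq)
  finally show ?thesis .
qed

text \<open>Instead of the Vandermonde determinant, apply the factorisation to
  \<open>p l = (X - x (l+1)) \<cdots> (X - x m)\<close>, for which both other matrices are triangular.\<close>

lemma det_coeff_matrix:
  fixes x :: "nat \<Rightarrow> real"
  shows "det (mat1 m (\<lambda>k j. coeff (\<Prod>i\<in>{1..m} - {j}. [:- x i, 1:]) (k - 1)))
   = (\<Prod>(l, j) \<in> {(l, j). 1 \<le> l \<and> l < j \<and> j \<le> m}. x l - x j)"
proof -
  define p where "p l = (\<Prod>i=Suc l..m. [:- x i, 1:])" for l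
  have deg: "degree (p l) = m - l" for l
    unfolding p_def by (subst degree_prod_eq_sum_degree) auto
  have lead: "coeff (p l) (m - l) = 1" for l
    using lead_coeff_prod[of "\<lambda>i. [:- x i, 1:]" "{Suc l..m}"] deg[of l] by (simp add: p_def)
  have "det (mat1 m (\<lambda>l j. poly_at_h m (complete_sym m x) j (p l))) =
     (\<Prod>l=1..m. poly_at_h m (complete_sym m x) l (p l))"
    \<comment> \<open>For \<open>j < l\<close> and \<open>a \<le> m - l\<close> the index
      \<open>a - m + j\<close> is negative, so every term vanishes.\<close>
    by (rule det_mat1_upper) (auto simp: poly_at_h_def deg complete_sym_def intro!: sum.neutral)
  also have "\<dots> = 1"
  proof (rule prod.neutral, rule)
    fix l assume l: "l \<in> {1..m}"
    \<comment> \<open>On the diagonal only \<open>a = m - l\<close> has a nonnegative index, namely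
      0, and there the leading coefficient is 1.\<close>
    have "poly_at_h m (complete_sym m x) l (p l)
      = (\<Sum>a\<le>m - l. if a = m - l then 1 else 0)"
      unfolding poly_at_h_def deg
    proof (rule sum.cong)
      fix a assume a: "a \<in> {..m - l}"
      show "coeff (p l) a * complete_sym m x (int a - int m + int l) = (if a = m - l then 1 else 0)"
      proof (cases "a = m - l")
        case True
        then have "int a - int m + int l = 0" using l by auto
        then show ?thesis using True lead by (simp add: complete_sym_eq complete_sym_on_0)
      next
        case False
        then have "int a - int m + int l < 0" using a l by auto
        then show ?thesis using False by (simp add: complete_sym_def)
      qed
    qed simp
    then show "poly_at_h m (complete_sym m x) l (p l) = 1" by simp
  qed
  finally have 1: "det (mat1 m (\<lambda>l j. poly_at_h m (complete_sym m x) j (p l))) = 1" .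
  have "det (mat1 m (\<lambda>l j. poly (p l) (x j))) = (\<Prod>l=1..m. poly (p l) (x l))"
    \<comment> \<open>For \<open>l < j \<le> m\<close> the point \<open>x j\<close> is a root of
      \<open>p l\<close>.\<close>
    by (rule det_mat1_lower) (auto simp: p_def poly_prod)
  also have "\<dots> = (\<Prod>l=1..m. \<Prod>j=Suc l..m. x l - x j)"
    by (simp add: p_def poly_prod)
  also have "\<dots> = (\<Prod>(l, j) \<in> (SIGMA l:{1..m}. {Suc l..m}). x l - x j)"
    by (subst prod.Sigma) auto
  also have "(SIGMA l:{1..m}. {Suc l..m}) = {(l, j). 1 \<le> l \<and> l < j \<and> j \<le> m}"
    by auto
  finally show ?thesis using det_poly_factor[of m p x] 1 by simp
qed

subsection \<open>Polynomial functions\<close>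

text \<open>Coefficients are collected over the fibres of \<open>e\<close>, so the closure proofs
  below may list the same exponent vector repeatedly.\<close>

lemma polynomial_fun_monomials:
  assumes "finite I"
  shows "polynomial_fun m (\<lambda>x. \<Sum>i\<in>I. c i * (\<Prod>k = 1..m. x k ^ e i k))"
  unfolding polynomial_fun_def
proof (intro exI conjI allI)
  show "finite (e ` I)" using assms by simp
  fix x :: "nat \<Rightarrow> real"
  show "(\<Sum>i\<in>I. c i * (\<Prod>k = 1..m. x k ^ e i k)) =
    (\<Sum>d\<in>e ` I. (\<Sum>i\<in>{i\<in>I. e i = d}. c i) * (\<Prod>k = 1..m. x k ^ d k))"
    using assms by (subst sum.image_gen[of I _ e]) (auto simp: sum_distrib_right intro!: sum.cong)
qed

lemma polynomial_fun_const: "polynomial_fun m (\<lambda>x. a)"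
  using polynomial_fun_monomials[of "{()}" m "\<lambda>_. a" "\<lambda>_ _. 0"] by simp

lemma polynomial_fun_add:
  assumes "polynomial_fun m f" and "polynomial_fun m g"
  shows "polynomial_fun m (\<lambda>x. f x + g x)"
proof -
  obtain E c where f: "finite E" "\<And>x. f x = (\<Sum>e\<in>E. c e * (\<Prod>i = 1..m. x i ^ e i))"
    using assms(1) unfolding polynomial_fun_def by blast
  obtain F d where g: "finite F" "\<And>x. g x = (\<Sum>e\<in>F. d e * (\<Prod>i = 1..m. x i ^ e i))"
    using assms(2) unfolding polynomial_fun_def by blast
  show ?thesis
    \<comment> \<open>The disjoint sum keeps exponents common to \<open>E\<close> and
      \<open>F\<close> apart.\<close>
    using polynomial_fun_monomials[of "E <+> F" m "case_sum c d" "case_sum id id"] f g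
    by (simp add: sum.Plus)
qed

lemma polynomial_fun_mult:
  assumes "polynomial_fun m f" and "polynomial_fun m g"
  shows "polynomial_fun m (\<lambda>x. f x * g x)"
proof -
  obtain E c where f: "finite E" "\<And>x. f x = (\<Sum>e\<in>E. c e * (\<Prod>i = 1..m. x i ^ e i))"
    using assms(1) unfolding polynomial_fun_def by blast
  obtain F d where g: "finite F" "\<And>x. g x = (\<Sum>e\<in>F. d e * (\<Prod>i = 1..m. x i ^ e i))"
    using assms(2) unfolding polynomial_fun_def by blast
  have "f x * g x = (\<Sum>q\<in>E \<times> F. (c (fst q) * d (snd q)) * (\<Prod>k = 1..m. x k ^ (fst q k + snd q k)))" for x
    unfolding f g sum_product sum.cartesian_product
    by (intro sum.cong) (auto simp: power_add prod.distrib)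
  then show ?thesis
    using polynomial_fun_monomials[of "E \<times> F" m "\<lambda>q. c (fst q) * d (snd q)" "\<lambda>q k. fst q k + snd q k"] f g
    by simp
qed

lemma polynomial_fun_sum:
  "(\<And>i. i \<in> I \<Longrightarrow> polynomial_fun m (f i)) \<Longrightarrow> polynomial_fun m (\<lambda>x. \<Sum>i\<in>I. f i x)"
  by (induction I rule: infinite_finite_induct)
    (auto intro: polynomial_fun_const polynomial_fun_add)

lemma polynomial_fun_prod:
  "(\<And>i. i \<in> I \<Longrightarrow> polynomial_fun m (f i)) \<Longrightarrow> polynomial_fun m (\<lambda>x. \<Prod>i\<in>I. f i x)"
  by (induction I rule: infinite_finite_induct)
    (auto intro: polynomial_fun_const polynomial_fun_mult)

lemma polynomial_fun_complete_sym: "polynomial_fun m (\<lambda>x. complete_sym m x r)"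
proof (cases "r < 0")
  case True
  then show ?thesis by (simp add: complete_sym_def polynomial_fun_const)
next
  case False
  then show ?thesis
    using polynomial_fun_monomials[OF finite_exponents, of "{1..m}" m "\<lambda>_. 1" "\<lambda>l. l" "nat r"]
    by (simp add: complete_sym_def)
qed

text \<open>The Leibniz formula expresses the determinant by sums and products of entries.\<close>

lemma polynomial_fun_det:
  assumes "\<And>i j. polynomial_fun m (\<lambda>x. a x i j)"
  shows "polynomial_fun m (\<lambda>x. det (mat1 n (a x)))"
proof -
  have eq: "det (mat1 n (a x)) = (\<Sum>\<pi> | \<pi> permutes {0..<n}. signof \<pi> * (\<Prod>i = 0..<n. a x (Suc i) (Suc (\<pi> i))))"
    for x
    by (subst det_def'[of _ n]) (auto simp: mat1_def intro!: sum.cong prod.cong)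
  show ?thesis unfolding eq
    by (intro polynomial_fun_sum polynomial_fun_mult polynomial_fun_const polynomial_fun_prod assms)
qed

text \<open>Moving the coordinates with different speeds makes them distinct for all but finitely many
  times.\<close>

lemma polynomial_fun_unique:
  assumes f: "polynomial_fun m f" and g: "polynomial_fun m g"
    and eq: "\<And>x. inj_on x {1..m} \<Longrightarrow> f x = g x"
  shows "f = g"
proof
  fix x :: "nat \<Rightarrow> real"
  define y where "y t i = x i + t * real i" for t i
  have cont: "isCont (\<lambda>t. h (y t)) 0" if poly: "polynomial_fun m h" for h
  proof -
    obtain E c where h: "finite E" "\<And>x. h x = (\<Sum>e\<in>E. c e * (\<Prod>i = 1..m. x i ^ e i))"
      using poly unfolding polynomial_fun_def by blast
    show ?thesis unfolding h(2) y_def by (intro continuous_intros)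
  qed
  \<comment> \<open>Coordinates \<open>i \<noteq> j\<close> meet only at this time. Pairs with
    \<open>i = j\<close> contribute just 0, by division by zero.\<close>
  define T where "T = (\<lambda>(i, j). (x i - x j) / (real j - real i)) ` ({1..m} \<times> {1..m})"
  have inj: "inj_on (y t) {1..m}" if "t \<notin> T" for t
  proof (rule inj_onI, rule ccontr)
    fix i j assume ij: "i \<in> {1..m}" "j \<in> {1..m}" "y t i = y t j" "i \<noteq> j"
    then have "t = (x i - x j) / (real j - real i)"
      by (auto simp: y_def field_simps)
    then show False using that ij unfolding T_def by auto
  qed
  \<comment> \<open>Time 0 may lie in \<open>T\<close>, as \<open>x\<close> itself may have equal
    coordinates; the punctured neighbourhood of 0 avoids it.\<close>
  have "finite (T - {0})" by (simp add: T_def)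
  then have "open (- (T - {0}))" by (intro open_Compl finite_imp_closed)
  then have "\<forall>\<^sub>F t in at 0. t \<in> - (T - {0})" by (rule eventually_at_in_open') simp
  moreover have "\<forall>\<^sub>F t in at (0::real). t \<noteq> 0" by (simp add: eventually_at_filter)
  ultimately have ev: "\<forall>\<^sub>F t in at 0. f (y t) = g (y t)"
    by eventually_elim (rule eq, rule inj, simp)
  \<comment> \<open>Both values are limits of the same function at 0, hence equal.\<close>
  have "((\<lambda>t. f (y t)) \<longlongrightarrow> f (y 0)) (at 0)" using cont[OF f] by (simp add: isCont_def)
  moreover have "((\<lambda>t. f (y t)) \<longlongrightarrow> g (y 0)) (at 0)"
    using cont[OF g] tendsto_cong[OF ev] by (simp add: isCont_def)
  ultimately have "f (y 0) = g (y 0)" by (intro tendsto_unique) auto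
  moreover have "y 0 = x" by (simp add: y_def fun_eq_iff)
  ultimately show "f x = g x" by simp
qed

section \<open>The determinantal formula for Hermitian Jacobi polynomials\<close>

theorem lemma1p11:
  fixes m :: nat and \<kappa>1 \<kappa>2 :: real and P :: "nat \<Rightarrow> real poly"
    and \<Lambda> :: "complex mat" and ev :: "nat \<Rightarrow> real" and \<tau> :: "nat \<Rightarrow> nat"
  assumes "m \<ge> 1"
    and "\<kappa>1 > real m / 2 - 1" and "\<kappa>2 > real m / 2 - 1"
    and "jacobi_polynomials (\<kappa>1 - real m / 2) (\<kappa>2 - real m / 2) P"
    and "\<Lambda> \<in> carrier_mat m m" and "mat_adjoint \<Lambda> = \<Lambda>"
    and "real_eigenvalues m \<Lambda> ev"
    and "is_partition m \<tau>"
  shows "hermitian_jacobi m P \<tau> ev =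
    det (mat1 m (\<lambda>l j. poly_at_h m (complete_sym m ev) j (P (\<tau> l + m - l))))"
proof -
  let ?p = "\<lambda>l. P (\<tau> l + m - l)"
  let ?f = "\<lambda>x. det (mat1 m (\<lambda>l j. poly_at_h m (complete_sym m x) j (?p l)))"
  let ?V = "\<lambda>x. \<Prod>(l, j) \<in> {(l, j). 1 \<le> l \<and> l < j \<and> j \<le> m}. x l - x j"
  have fin: "finite {(l, j). 1 \<le> l \<and> l < j \<and> j \<le> m}"
    by (rule finite_subset[of _ "{1..m} \<times> {1..m}"]) auto
  have poly: "polynomial_fun m ?f"
    unfolding poly_at_h_def
    by (intro polynomial_fun_det polynomial_fun_sum polynomial_fun_mult polynomial_fun_const
        polynomial_fun_complete_sym)
  have quot: "?f x = det (mat1 m (\<lambda>l j. poly (?p l) (x j))) / ?V x" if "inj_on x {1..m}" for x :: "nat \<Rightarrow> real"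
  proof -
    have "x l \<noteq> x j" if "1 \<le> l" "l < j" "j \<le> m" for l j
      using inj_onD[OF \<open>inj_on x {1..m}\<close>, of l j] that by auto
    then have "?V x \<noteq> 0" using fin by auto
    moreover have "det (mat1 m (\<lambda>l j. poly (?p l) (x j))) = ?f x * ?V x"
      by (simp only: det_poly_factor det_coeff_matrix)
    ultimately show ?thesis by (intro eq_divide_imp) simp_all
  qed
  \<comment> \<open>The umbral determinant is itself the polynomial extension of the quotient: it
    witnesses existence for \<open>THE\<close>, and \<open>polynomial_fun_unique\<close> gives
    uniqueness. Coinciding eigenvalues are thereby included.\<close>
  have "hermitian_jacobi m P \<tau> = ?f"
    unfolding hermitian_jacobi_def
  proof (rule the_equality)
    show "polynomial_fun m ?f \<and> (\<forall>x. inj_on x {1..m} \<longrightarrow>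
      ?f x = det (mat1 m (\<lambda>l j. poly (?p l) (x j))) / ?V x)"
      using poly quot by blast
    fix g assume "polynomial_fun m g \<and> (\<forall>x. inj_on x {1..m} \<longrightarrow>
      g x = det (mat1 m (\<lambda>l j. poly (?p l) (x j))) / ?V x)"
    then show "g = ?f"
      by (intro polynomial_fun_unique[OF _ poly]) (simp_all only: quot)
  qed
  then show ?thesis by simp
qed

end
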